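(* Fix $i\in\{1,\dots,m\}$ and let $b_i$ be the smallest non-zero positive value of $\langle\lambda,\check{\gamma}\rangle$ for $\gamma\in\Phi_N^i$ (with $b_i=\infty$ if there is no such value). Let $s\in\mathbb{R}$ be such that $\lambda+s\tilde{\alpha}$ is algebraically integral. Let $\mathcal{M}(r_i,\Pi\otimes|s\tilde{\alpha}|)(1)$ be the premotivic structure described in the context, of weight $\mathrm{wt}=-2is-2$ and with Hodge numbers $h^{p,q}=\dim H^{p,q}$. (1) If $\mathrm{wt}$ is odd, or if $\mathrm{wt}$ is even but $h^{\mathrm{wt}/2,\mathrm{wt}/2}=0$, then $\mathcal{M}(r_i,\Pi\otimes|s\tilde{\alpha}|)(1)$ is critical for $0<s\leq\frac{b_i-1}{i}$. (2) If $\mathrm{wt}$ is even and $h^{\mathrm{wt}/2,\mathrm{wt}/2}\neq 0$, suppose that $F_\infty$ acts on $H^{\mathrm{wt}/2,\mathrm{wt}/2}$ by a scalar (necessarily $(-1)^t$ with $t=0$ or $1$). Then $\mathcal{M}(r_i,\Pi\otimes|s\tilde{\alpha}|)(1)$ is critical for $0<s\leq\frac{b_i-1}{i}$, subject to the extra condition $t=0$.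
   Context: Group-theoretic setting. $G/\mathbb{Q}$ is a connected, split reductive group with split maximal torus $T$, roots $\Phi\subset X^*(T)$, positive roots $\Phi_G^+$, simple positive roots $\Delta_G$, and Weyl group $W_G$; $\check{\gamma}\in X_*(T)$ is the coroot of $\gamma\in\Phi$, and $\langle\cdot,\cdot\rangle$ is the natural pairing $X^*(T)\times X_*(T)\to\mathbb{Z}$, extended to real coefficients. Fix $\alpha\in\Delta_G$ and let $P=MN$ be the maximal parabolic subgroup with unipotent radical $N$ and Levi subgroup $M\supset T$ characterised by $\Delta_M=\Delta_G\setminus\{\alpha\}$. $W_M$ is the Weyl group of $M$. $\Phi_N$ is the set of roots occurring in the Lie algebra of $N$, $\rho_P$ is half the sum of the elements of $\Phi_N$, and $\tilde{\alpha}=\rho_P/\langle\rho_P,\check{\alpha}\rangle$. For $i\ge 1$, $\Phi_N^i=\{\gamma\in\Phi_N:\langle\tilde{\alpha},\check{\gamma}\rangle=i\}$; $m$ is the largest $i$ with $\Phi_N^i\ne\emptyset$. Here $i$ always denotes this positive integer, not $\sqrt{-1}$. Automorphic setting. $\Pi$ is an irreducible, cuspidal, unitary automorphic representation of $M(\mathbb{A})$, trivial on $A(\mathbb{A})$ where $A=Z(M)^0$. $\lambda\in X^*(T)\otimes\mathbb{R}$ is the infinitesimal character of $\Pi_\infty$ (via the Harish-Chandra isomorphism, with respect to the Lie algebra of $T(\mathbb{R})$), chosen in its $W_M$-orbit to be dominant with respect to $\Delta_M$. One says $\lambda+s\tilde{\alpha}$ is algebraically integral if $\langle\lambda+s\tilde{\alpha},\check{\gamma}\rangle\in\mathbb{Z}$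 for all $\gamma\in\Phi$. Let $\hat{M}\subset\hat{P}\subset\hat{G}$ be the corresponding Levi and maximal parabolic in the Langlands dual group, and $\hat{\mathfrak n}$ the Lie algebra of the unipotent radical of $\hat P$. The adjoint representation $r$ of $\hat M$ on $\hat{\mathfrak n}$ decomposes as $r=\bigoplus_{i=1}^m r_i$, where $r_i$ acts on the sum of the root spaces for $\{\check\gamma:\gamma\in\Phi_N^i\}$. Motivic setting (standing assumption). It is assumed that for $s\in\mathbb{R}$ with $\lambda+s\tilde{\alpha}$ algebraically integral there exists the motive $\mathcal{M}(r_i,\Pi\otimes|s\tilde{\alpha}|)$ over $\mathbb{Q}$ conjecturally attached to $\Pi\otimes|s\tilde{\alpha}|$ and $r_i$, with coefficients in a number field $E\subset\mathbb{C}$, or at least the associated premotivic structure: a Betti realisation $H_B$ (a finite-dimensional $E$-vector space) with an involution $F_\infty$ (complex conjugation) and a Hodge decomposition $H_B\otimes_E\mathbb{C}=\bigoplus_{p,q} H^{p,q}$ such that $F_\infty$ exchanges $H^{p,q}$ and $H^{q,p}$; a de Rham realisation $H_{\mathrm{dR}}$ (an $E$-vector space) with a decreasing filtration $\mathrm{Fil}^\bullet$; and a comparison isomorphism $H_B\otimes_E\mathbb{C}\simeq H_{\mathrm{dR}}\otimes_E\mathbb{C}$ under which $\mathrm{Fil}^k\otimes\mathbb{C}$ corresponds to $\bigoplus_{p\ge k}H^{p,q}$. Its Hodge type, with multiplicities, is $\{(-\langle\lambda,\check{\gamma}\rangle-is,\ \langle\lambda,\check{\gamma}\rangle-is):\gamma\in\Phi_N^i\}$.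 $\mathcal{M}(r_i,\Pi\otimes|s\tilde{\alpha}|)(1)$ is its Tate twist, whose Hodge type is obtained by replacing each $(p,q)$ by $(p-1,q-1)$; so it has weight $\mathrm{wt}=-2is-2$ (that is, $p+q=\mathrm{wt}$ for all $(p,q)$ in the Hodge type). In the claim, $H^{p,q}$, $h^{p,q}$ and $F_\infty$ refer to $H_B(\mathcal{M}(r_i,\Pi\otimes|s\tilde{\alpha}|)(1))\otimes\mathbb{C}$. Following Deligne, $\mathcal{M}(r_i,\Pi\otimes|s\tilde{\alpha}|)(1)$ is called critical if $$\dim\left(H_B(\mathcal{M}(r_i,\Pi\otimes|s\tilde{\alpha}|)(1))^{+}\right)=\dim\left(H_{\mathrm{dR}}(\mathcal{M}(r_i,\Pi\otimes|s\tilde{\alpha}|)(1))/\mathrm{Fil}^0\right),$$ where $+$ denotes the $+1$-eigenspace of $F_\infty$. *)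

theory Defs
  imports "HOL-Analysis.Analysis" "HOL-Library.Multiset"
begin

section \<open>Root data, parabolics and weights\<close>

text \<open>
  A connected split reductive group with a split maximal torus \<open>T\<close> enters through its root datum.
  A \<open>\<int>\<close>-basis of \<open>X\<^sup>*(T)\<close> and the dual basis of \<open>X\<^sub>*(T)\<close> identify both lattices with
  \<open>\<int>\<^sup>n\<close>, the natural (perfect) pairing with the dot product, and \<open>X\<^sup>*(T) \<otimes> \<real>\<close> with \<open>\<real>\<^sup>n\<close>.
\<close>

definition lattice_pairing :: "int ^ 'n \<Rightarrow> int ^ 'n \<Rightarrow> int" where
  "lattice_pairing x y = (\<Sum>j\<in>UNIV. x $ j * y $ j)"

definition pairing :: "real ^ 'n \<Rightarrow> int ^ 'n \<Rightarrow> real" where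
  "pairing x y = (\<Sum>j\<in>UNIV. x $ j * of_int (y $ j))"

definition real_weight :: "int ^ 'n \<Rightarrow> real ^ 'n" where
  "real_weight x = (\<chi> j. of_int (x $ j))"

text \<open>The last axiom says that the datum is reduced, as it is for every reductive group over a
  field.\<close>

locale reduced_root_datum =
  fixes \<Phi> :: "(int ^ 'n) set" and coroot :: "int ^ 'n \<Rightarrow> int ^ 'n"
  assumes finite_roots: "finite \<Phi>"
    and inj_coroot: "inj_on coroot \<Phi>"
    and pairing_coroot_self: "\<gamma> \<in> \<Phi> \<Longrightarrow> lattice_pairing \<gamma> (coroot \<gamma>) = 2"
    and reflection_root:
      "\<gamma> \<in> \<Phi> \<Longrightarrow> \<beta> \<in> \<Phi> \<Longrightarrow> \<beta> - lattice_pairing \<beta> (coroot \<gamma>) *s \<gamma> \<in> \<Phi>"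
    and reflection_coroot:
      "\<gamma> \<in> \<Phi> \<Longrightarrow> \<beta> \<in> \<Phi> \<Longrightarrow>
        coroot \<beta> - lattice_pairing \<gamma> (coroot \<beta>) *s coroot \<gamma> \<in> coroot ` \<Phi>"
    and reduced: "\<gamma> \<in> \<Phi> \<Longrightarrow> 2 *s \<gamma> \<notin> \<Phi>"

definition is_positive_system :: "(int ^ 'n) set \<Rightarrow> (int ^ 'n) set \<Rightarrow> bool" where
  "is_positive_system \<Phi> Pos \<longleftrightarrow>
     (\<exists>h :: real ^ 'n. (\<forall>\<gamma>\<in>\<Phi>. real_weight \<gamma> \<bullet> h \<noteq> 0) \<and> Pos = {\<gamma>\<in>\<Phi>. real_weight \<gamma> \<bullet> h > 0})"

definition simple_roots :: "(int ^ 'n) set \<Rightarrow> (int ^ 'n) set" where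
  "simple_roots Pos = {\<gamma>\<in>Pos. \<not> (\<exists>\<beta>\<in>Pos. \<exists>\<delta>\<in>Pos. \<gamma> = \<beta> + \<delta>)}"

definition levi_simple_roots :: "(int ^ 'n) set \<Rightarrow> int ^ 'n \<Rightarrow> (int ^ 'n) set" where
  "levi_simple_roots Pos \<alpha> = simple_roots Pos - {\<alpha>}"

definition levi_roots :: "(int ^ 'n) set \<Rightarrow> (int ^ 'n) set \<Rightarrow> int ^ 'n \<Rightarrow> (int ^ 'n) set" where
  "levi_roots \<Phi> Pos \<alpha> =
     {\<gamma>\<in>\<Phi>. \<exists>c :: int ^ 'n \<Rightarrow> int. \<gamma> = (\<Sum>\<beta>\<in>levi_simple_roots Pos \<alpha>. c \<beta> *s \<beta>)}"

definition nilradical_roots :: "(int ^ 'n) set \<Rightarrow> (int ^ 'n) set \<Rightarrow> int ^ 'n \<Rightarrow> (int ^ 'n) set" where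
  "nilradical_roots \<Phi> Pos \<alpha> = Pos - levi_roots \<Phi> Pos \<alpha>"

definition rho_P :: "(int ^ 'n) set \<Rightarrow> (int ^ 'n) set \<Rightarrow> int ^ 'n \<Rightarrow> real ^ 'n" where
  "rho_P \<Phi> Pos \<alpha> = (1/2) *\<^sub>R (\<Sum>\<gamma>\<in>nilradical_roots \<Phi> Pos \<alpha>. real_weight \<gamma>)"

definition alpha_tilde ::
  "(int ^ 'n) set \<Rightarrow> (int ^ 'n \<Rightarrow> int ^ 'n) \<Rightarrow> (int ^ 'n) set \<Rightarrow> int ^ 'n \<Rightarrow> real ^ 'n" where
  "alpha_tilde \<Phi> coroot Pos \<alpha> =
     (1 / pairing (rho_P \<Phi> Pos \<alpha>) (coroot \<alpha>)) *\<^sub>R rho_P \<Phi> Pos \<alpha>"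

definition graded_roots ::
  "(int ^ 'n) set \<Rightarrow> (int ^ 'n \<Rightarrow> int ^ 'n) \<Rightarrow> (int ^ 'n) set \<Rightarrow> int ^ 'n \<Rightarrow> nat \<Rightarrow> (int ^ 'n) set" where
  "graded_roots \<Phi> coroot Pos \<alpha> i =
     {\<gamma>\<in>nilradical_roots \<Phi> Pos \<alpha>. pairing (alpha_tilde \<Phi> coroot Pos \<alpha>) (coroot \<gamma>) = real i}"

definition max_grade ::
  "(int ^ 'n) set \<Rightarrow> (int ^ 'n \<Rightarrow> int ^ 'n) \<Rightarrow> (int ^ 'n) set \<Rightarrow> int ^ 'n \<Rightarrow> nat" where
  "max_grade \<Phi> coroot Pos \<alpha> = Max {i. i \<ge> 1 \<and> graded_roots \<Phi> coroot Pos \<alpha> i \<noteq> {}}"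

definition dominant :: "(int ^ 'n \<Rightarrow> int ^ 'n) \<Rightarrow> (int ^ 'n) set \<Rightarrow> real ^ 'n \<Rightarrow> bool" where
  "dominant coroot \<Delta> x \<longleftrightarrow> (\<forall>\<beta>\<in>\<Delta>. pairing x (coroot \<beta>) \<ge> 0)"

definition algebraically_integral ::
  "(int ^ 'n) set \<Rightarrow> (int ^ 'n \<Rightarrow> int ^ 'n) \<Rightarrow> real ^ 'n \<Rightarrow> bool" where
  "algebraically_integral \<Phi> coroot x \<longleftrightarrow> (\<forall>\<gamma>\<in>\<Phi>. pairing x (coroot \<gamma>) \<in> \<int>)"

definition least_positive_value ::
  "(int ^ 'n \<Rightarrow> int ^ 'n) \<Rightarrow> real ^ 'n \<Rightarrow> (int ^ 'n) set \<Rightarrow> ereal" where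
  "least_positive_value coroot x R =
     (let V = {pairing x (coroot \<gamma>) | \<gamma>. \<gamma> \<in> R \<and> pairing x (coroot \<gamma>) > 0}
      in if V = {} then \<infinity> else ereal (Min V))"


section \<open>Premotivic structures\<close>

text \<open>A number field \<open>E \<subset> \<complex>\<close> is a field type with an embedding \<open>\<iota>\<close>.\<close>

locale embedded_number_field =
  fixes \<iota> :: "'e :: field_char_0 \<Rightarrow> complex"
  assumes embed_add: "\<iota> (a + b) = \<iota> a + \<iota> b"
    and embed_mult: "\<iota> (a * b) = \<iota> a * \<iota> b"
    and embed_one: "\<iota> 1 = 1"
    and finite_degree: "\<exists>B. finite_dimensional_vector_space (\<lambda>(q::rat) (x::'e). of_rat q * x) B"

text \<open>\<open>j : V \<rightarrow> W\<close> exhibits the complex space \<open>W\<close> as \<open>V \<otimes>\<^sub>E \<complex>\<close>, via \<open>v \<mapsto> v \<otimes> 1\<close>: it is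
  \<open>E\<close>-linear and takes \<open>E\<close>-bases to \<open>\<complex>\<close>-bases.\<close>

locale complexification =
  source: vector_space sV + target: vector_space sW
  for \<iota> :: "'e :: field \<Rightarrow> complex"
    and sV :: "'e \<Rightarrow> 'v :: ab_group_add \<Rightarrow> 'v"
    and sW :: "complex \<Rightarrow> 'w :: ab_group_add \<Rightarrow> 'w" +
  fixes j :: "'v \<Rightarrow> 'w"
  assumes map_add: "j (v + v') = j v + j v'"
    and map_scale: "j (sV a v) = sW (\<iota> a) (j v)"
    and map_independent: "\<not> source.dependent S \<Longrightarrow> inj_on j S \<and> \<not> target.dependent (j ` S)"
    and map_spanning: "target.span (range j) = UNIV"

definition is_internal_direct_sum ::
  "('k :: field \<Rightarrow> 'v :: ab_group_add \<Rightarrow> 'v) \<Rightarrow> ('x \<Rightarrow> 'v set) \<Rightarrow> bool" where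
  "is_internal_direct_sum sc U \<longleftrightarrow>
     (\<forall>x. module.subspace sc (U x)) \<and>
     (\<forall>v. \<exists>!f. (\<forall>x. f x \<in> U x) \<and> finite {x. f x \<noteq> 0} \<and> v = (\<Sum>x | f x \<noteq> 0. f x))"

text \<open>
  Subscripts \<open>C\<close> mark complexifications; \<open>FrobC\<close> is the \<open>\<complex>\<close>-linear extension of the involution
  \<open>Frob\<close> (that is, \<open>F\<^sub>\<infinity>\<close>) of the Betti realisation.
\<close>

record ('e, 'b, 'bc, 'd, 'dc) premotive =
  embed :: "'e \<Rightarrow> complex"
  scaleB :: "'e \<Rightarrow> 'b \<Rightarrow> 'b"
  scaleBC :: "complex \<Rightarrow> 'bc \<Rightarrow> 'bc"
  incB :: "'b \<Rightarrow> 'bc"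
  Frob :: "'b \<Rightarrow> 'b"
  FrobC :: "'bc \<Rightarrow> 'bc"
  Hodge :: "int \<Rightarrow> int \<Rightarrow> 'bc set"
  scaleD :: "'e \<Rightarrow> 'd \<Rightarrow> 'd"
  scaleDC :: "complex \<Rightarrow> 'dc \<Rightarrow> 'dc"
  incD :: "'d \<Rightarrow> 'dc"
  Fil :: "int \<Rightarrow> 'd set"
  comparison :: "'bc \<Rightarrow> 'dc"

locale premotivic_structure =
  fixes M :: "('e :: field_char_0, 'b :: ab_group_add, 'bc :: ab_group_add,
               'd :: ab_group_add, 'dc :: ab_group_add) premotive"
  assumes number_field: "embedded_number_field (embed M)"
    and betti_finite_dim: "\<exists>B. finite_dimensional_vector_space (scaleB M) B"
    and betti_complexification: "complexification (embed M) (scaleB M) (scaleBC M) (incB M)"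
    and Frob_linear: "Vector_Spaces.linear (scaleB M) (scaleB M) (Frob M)"
    and Frob_involution: "Frob M (Frob M v) = v"
    and FrobC_linear: "Vector_Spaces.linear (scaleBC M) (scaleBC M) (FrobC M)"
    and FrobC_extends: "FrobC M (incB M v) = incB M (Frob M v)"
    and Hodge_decomposition: "is_internal_direct_sum (scaleBC M) (\<lambda>(p, q). Hodge M p q)"
    and Frob_Hodge: "FrobC M ` Hodge M p q = Hodge M q p"
    and deRham_complexification: "complexification (embed M) (scaleD M) (scaleDC M) (incD M)"
    and Fil_subspace: "module.subspace (scaleD M) (Fil M k)"
    and Fil_decreasing: "k \<le> l \<Longrightarrow> Fil M l \<subseteq> Fil M k"
    and comparison_linear: "Vector_Spaces.linear (scaleBC M) (scaleDC M) (comparison M)"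
    and comparison_bij: "bij (comparison M)"
    and comparison_Fil:
      "comparison M ` module.span (scaleBC M) (\<Union>{Hodge M p q | p q. p \<ge> k}) =
         module.span (scaleDC M) (incD M ` Fil M k)"

definition hodge_number ::
  "('e, 'b, 'bc :: ab_group_add, 'd, 'dc) premotive \<Rightarrow> int \<Rightarrow> int \<Rightarrow> nat" where
  "hodge_number M p q = vector_space.dim (scaleBC M) (Hodge M p q)"

text \<open>The prescribed Hodge type is a multiset of real pairs; having it entails that these pairs
  are integral.\<close>

definition has_hodge_type ::
  "('e, 'b, 'bc :: ab_group_add, 'd, 'dc) premotive \<Rightarrow> (real \<times> real) multiset \<Rightarrow> bool" where
  "has_hodge_type M A \<longleftrightarrow>
     (\<forall>x\<in>#A. fst x \<in> \<int> \<and> snd x \<in> \<int>) \<and>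
     (\<forall>p q. hodge_number M p q = count A (of_int p, of_int q))"

text \<open>
  Twist by the Tate structure \<open>\<rat>(1)\<close>, whose Betti lattice is \<open>2\<pi>\<i>\<rat>\<close> inside \<open>\<complex>\<close>: complex
  conjugation acts on it by \<open>-1\<close>, it is of type \<open>(-1,-1)\<close>, and the comparison isomorphism is
  multiplication by \<open>2\<pi>\<i>\<close>. The underlying spaces are identified with those of \<open>M\<close> by means of the
  generators \<open>2\<pi>\<i>\<close> and \<open>1\<close> of its Betti and de Rham realisations.
\<close>

definition tate_twist ::
  "('e, 'b :: ab_group_add, 'bc :: ab_group_add, 'd, 'dc) premotive
     \<Rightarrow> ('e, 'b, 'bc, 'd, 'dc) premotive" where
  "tate_twist M = M
     \<lparr> Frob := (\<lambda>v. - Frob M v),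
       FrobC := (\<lambda>v. - FrobC M v),
       Hodge := (\<lambda>p q. Hodge M (p + 1) (q + 1)),
       Fil := (\<lambda>k. Fil M (k + 1)),
       comparison := (\<lambda>v. scaleDC M (2 * of_real pi * \<i>) (comparison M v)) \<rparr>"

text \<open>The dimension of the finite-dimensional quotient \<open>H\<^sub>d\<^sub>R / Fil\<^sup>0\<close> is written as the difference
  of the dimensions.\<close>

definition critical ::
  "('e :: field, 'b :: ab_group_add, 'bc, 'd :: ab_group_add, 'dc) premotive \<Rightarrow> bool" where
  "critical M \<longleftrightarrow>
     vector_space.dim (scaleB M) {v. Frob M v = v} =
     vector_space.dim (scaleD M) UNIV - vector_space.dim (scaleD M) (Fil M 0)"

end

theory Submission
  imports Defs
begin

text \<open>
  Let \<open>W\<close> be the complexified Betti realisation of the untwisted structure, \<open>F\<close> the involution on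
  it and \<open>U\<close> the sum of the \<open>H\<^sup>p\<^sup>q\<close> with \<open>p \<ge> 1\<close>. Since twisting negates \<open>F\<close>, criticality of the
  twist says that the \<open>-1\<close>-eigenspace of \<open>F\<close> has dimension \<open>dim W - dim U\<close>. For \<open>s\<close> in the given
  range, the symmetry of the Hodge type under \<open>(p, q) \<mapsto> (q, p)\<close> makes \<open>U\<close> the sum of the \<open>H\<^sup>p\<^sup>q\<close> with
  \<open>p > q\<close>. Then \<open>U\<close> meets the eigenspace trivially because \<open>F\<close> moves \<open>U\<close> into the part with
  \<open>p < q\<close>, and \<open>U\<close> and the eigenspace span \<open>W\<close> because \<open>w = (w - F w) + F w\<close> and \<open>F = -1\<close> on the
  middle part.
\<close>

section \<open>Extension of scalars to the complex numbers\<close>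

lemma (in complexification) map_zero: "j 0 = 0"
  using map_add[of 0 0] by simp

lemma (in complexification) map_span:
  assumes "v \<in> source.span S"
  shows "j v \<in> target.span (j ` S)"
  using assms
proof (induction rule: source.span_induct_alt)
  case base
  show ?case by (simp add: map_zero target.span_zero)
next
  case (step c x y)
  then show ?case
    by (simp add: map_add map_scale target.span_add target.span_scale target.span_base)
qed

text \<open>A maximal independent subset of \<open>S\<close> goes to one of the image, since
  \<open>j\<close> preserves independence and spans. This turns dimensions over the base field into
  complex ones.\<close>

lemma (in complexification) dim_image: "target.dim (j ` S) = source.dim S"
proof -
  obtain B where B: "B \<subseteq> S" "\<not> source.dependent B" "S \<subseteq> source.span B" "card B = source.dim S"
    using source.basis_exists .
  have "j ` S \<subseteq> target.span (j ` B)"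
    using B(3) map_span by blast
  moreover have "card (j ` B) = source.dim S"
    using map_independent[OF B(2)] B(4) by (simp add: card_image)
  ultimately show ?thesis
    using B(1) map_independent[OF B(2)] by (intro target.dim_unique[of "j ` B"]) auto
qed

lemma (in complexification) finite_dimensional_target:
  assumes "finite_dimensional_vector_space sV B"
  shows "finite_dimensional_vector_space sW (j ` B)"
proof -
  interpret V: finite_dimensional_vector_space sV B by fact
  have "range j \<subseteq> target.span (j ` B)"
    using map_span[of _ B] V.span_Basis by auto
  then have "target.span (j ` B) = UNIV"
    using target.span_minimal[OF _ target.subspace_span] map_spanning by blast
  then show ?thesis
    using map_independent[OF V.independent_Basis] V.finite_Basis by unfold_locales auto
qed

text \<open>The range of \<open>j\<close> spans the target, so a linear map is determined by its
  values there, and being an involution passes from \<open>F\<close> to \<open>G\<close>.\<close>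

lemma (in complexification) involution_extends:
  assumes "Vector_Spaces.linear sW sW G" "\<And>v. G (j v) = j (F v)" "\<And>v. F (F v) = v"
  shows "G (G w) = w"
proof -
  interpret G: Vector_Spaces.linear sW sW G by fact
  have "w \<in> target.span (range j)" by (simp add: map_spanning)
  then show ?thesis
    by (induction rule: target.span_induct_alt)
      (auto simp: G.zero G.add G.scale assms)
qed

text \<open>The eigenspace is the image of a map that is already defined before complexification: on
  \<open>j v\<close> the difference \<open>w - G w\<close> is \<open>j (v - F v)\<close>.\<close>

lemma (in complexification) span_image_antiinvariants:
  assumes "Vector_Spaces.linear sV sV F" "\<And>v. F (F v) = v"
    and "Vector_Spaces.linear sW sW G" "\<And>v. G (j v) = j (F v)"
  shows "target.span (j ` {v. F v = - v}) = {w. G w = - w}" (is "?S = ?R")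
proof
  interpret F: Vector_Spaces.linear sV sV F by fact
  interpret G: Vector_Spaces.linear sW sW G by fact
  have neg: "j (- v) = - j v" for v
    using map_add[of v "- v"] by (simp add: map_zero eq_neg_iff_add_eq_0 add.commute)
  show "?S \<subseteq> ?R"
  proof (rule target.span_minimal)
    show "j ` {v. F v = - v} \<subseteq> ?R" by (auto simp: assms(4) neg)
    show "target.subspace ?R"
      by (auto simp: target.subspace_def G.zero G.add G.scale)
  qed
  \<comment> \<open>Up to a factor 2 this is the projector onto the anti-invariants; the factor is
    divided out at the end.\<close>
  have anti: "w - G w \<in> ?S" for w
  proof -
    have "w \<in> target.span (range j)" by (simp add: map_spanning)
    then show ?thesis
    proof (induction rule: target.span_induct_alt)
      case base
      show ?case by (simp add: G.zero target.span_zero)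
    next
      case (step c x y)
      then obtain v where v: "x = j v" by auto
      have "x - G x = j (v - F v)"
        using map_add[of v "- F v"] by (simp add: v assms(4) neg)
      moreover have "F (v - F v) = - (v - F v)" by (simp add: F.diff assms(2))
      ultimately have "x - G x \<in> ?S" by (auto intro: target.span_base)
      then have "sW c (x - G x) + (y - G y) \<in> ?S"
        using step by (intro target.span_add target.span_scale)
      then show ?case
        by (simp add: G.add G.scale target.scale_right_diff_distrib algebra_simps)
    qed
  qed
  show "?R \<subseteq> ?S"
  proof
    fix w assume "w \<in> ?R"
    then have "w - G w = sW 2 w"
      using target.scale_left_distrib[of 1 1 w] by simp
    then have "sW (1/2) (w - G w) = w" by simp
    then show "w \<in> ?S" using target.span_scale[OF anti] by metis
  qed
qed

section \<open>Spans of summands in an internal direct sum\<close>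

lemma (in vector_space) direct_sum_span_UNIV:
  assumes "is_internal_direct_sum scale U"
  shows "span (\<Union>x. U x) = UNIV"
proof -
  have "v \<in> span (\<Union>x. U x)" for v
  proof -
    obtain f where f: "\<forall>x. f x \<in> U x" "v = (\<Sum>x | f x \<noteq> 0. f x)"
      using assms unfolding is_internal_direct_sum_def by blast
    show ?thesis
      unfolding f(2) using f(1) by (intro span_sum span_base) blast
  qed
  then show ?thesis by blast
qed

text \<open>Produces a family in the format of \<open>is_internal_direct_sum\<close> with support in
  \<open>A\<close>, so that the uniqueness there can be applied to it.\<close>

lemma (in vector_space) direct_sum_component:
  assumes "\<And>x. subspace (U x)" "v \<in> span (\<Union>x\<in>A. U x)"
  shows "\<exists>f. (\<forall>x. f x \<in> U x) \<and> finite {x. f x \<noteq> 0} \<and> {x. f x \<noteq> 0} \<subseteq> A \<and> v = (\<Sum>x | f x \<noteq> 0. f x)"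
  using assms(2)
proof (induction rule: span_induct_alt)
  case base
  show ?case
    using assms(1) by (intro exI[of _ "\<lambda>_. 0"]) (auto intro: subspace_0)
next
  case (step c w y)
  then obtain a f where a: "a \<in> A" "w \<in> U a"
    and f: "\<forall>x. f x \<in> U x" "finite {x. f x \<noteq> 0}" "{x. f x \<noteq> 0} \<subseteq> A" "y = (\<Sum>x | f x \<noteq> 0. f x)"
    by blast
  define g where "g = f(a := scale c w + f a)"
  \<comment> \<open>Cancellation may remove \<open>a\<close> from the support of \<open>g\<close>,
    so both sums are compared over the common finite set \<open>S\<close>.\<close>
  define S where "S = insert a {x. f x \<noteq> 0}"
  have S: "finite S" "{x. g x \<noteq> 0} \<subseteq> S" "S \<subseteq> A"
    using f a by (auto simp: S_def g_def)
  have "(\<Sum>x | g x \<noteq> 0. g x) = sum g S"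
    using S by (intro sum.mono_neutral_left) auto
  also have "\<dots> = scale c w + sum f S"
    using f(2) by (simp add: S_def g_def sum.insert_remove add.assoc)
  also have "sum f S = y"
    unfolding f(4) using S by (intro sum.mono_neutral_right) (auto simp: S_def)
  finally have "scale c w + y = (\<Sum>x | g x \<noteq> 0. g x)" by simp
  moreover have "\<forall>x. g x \<in> U x"
    using f(1) a(2) subspace_add[OF assms(1) subspace_scale[OF assms(1)]] by (simp add: g_def)
  ultimately show ?case
    using S finite_subset by blast
qed

text \<open>The two memberships give decompositions of \<open>v\<close> supported in
  \<open>A\<close> and in \<open>B\<close>; by uniqueness they agree, so their common support is
  empty.\<close>

lemma (in vector_space) direct_sum_span_disjoint:
  assumes U: "is_internal_direct_sum scale U" and "A \<inter> B = {}"
    and v: "v \<in> span (\<Union>x\<in>A. U x)" "v \<in> span (\<Union>x\<in>B. U x)"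
  shows "v = 0"
proof -
  have sub: "\<And>x. subspace (U x)"
    and unique: "\<exists>!f. (\<forall>x. f x \<in> U x) \<and> finite {x. f x \<noteq> 0} \<and> v = (\<Sum>x | f x \<noteq> 0. f x)"
    using U unfolding is_internal_direct_sum_def by blast+
  obtain f where f: "\<forall>x. f x \<in> U x" "finite {x. f x \<noteq> 0}" "{x. f x \<noteq> 0} \<subseteq> A"
      "v = (\<Sum>x | f x \<noteq> 0. f x)"
    using direct_sum_component[OF sub v(1)] by blast
  obtain g where g: "\<forall>x. g x \<in> U x" "finite {x. g x \<noteq> 0}" "{x. g x \<noteq> 0} \<subseteq> B"
      "v = (\<Sum>x | g x \<noteq> 0. g x)"
    using direct_sum_component[OF sub v(2)] by blast
  have "f = g"
    using unique f g by blast
  then have "{x. f x \<noteq> 0} = {}"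
    using f(3) g(3) assms(2) by blast
  then show ?thesis using f(4) by simp
qed

section \<open>Criticality as linear algebra on the complexified Betti realisation\<close>

context premotivic_structure
begin

interpretation W: vector_space "scaleBC M"
  using complexification.axioms(2)[OF betti_complexification] .

interpretation betti: complexification "embed M" "scaleB M" "scaleBC M" "incB M"
  by (rule betti_complexification)

interpretation deRham: complexification "embed M" "scaleD M" "scaleDC M" "incD M"
  by (rule deRham_complexification)

lemma finite_dimensional_BC: "\<exists>B. finite_dimensional_vector_space (scaleBC M) B"
proof -
  obtain B where "finite_dimensional_vector_space (scaleB M) B"
    using betti_finite_dim ..
  then have "finite_dimensional_vector_space (scaleBC M) (incB M ` B)"
    by (rule betti.finite_dimensional_target)
  then show ?thesis ..
qed

lemma Hodge_subspace: "module.subspace (scaleBC M) (Hodge M p q)"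
proof -
  have "module.subspace (scaleBC M) (case (p, q) of (p, q) \<Rightarrow> Hodge M p q)"
    using Hodge_decomposition unfolding is_internal_direct_sum_def by blast
  then show ?thesis by simp
qed

lemma FrobC_involution: "FrobC M (FrobC M w) = w"
  by (rule betti.involution_extends[OF FrobC_linear FrobC_extends Frob_involution])

text \<open>As \<open>dim\<close> is 0 on infinite-dimensional spaces too, the proof rests on finite
  dimension.\<close>

lemma hodge_number_eq_0: "hodge_number M p q = 0 \<longleftrightarrow> Hodge M p q = {0}"
proof -
  obtain B where "finite_dimensional_vector_space (scaleBC M) B"
    using finite_dimensional_BC by blast
  then interpret finite_dimensional_vector_space "scaleBC M" B .
  show ?thesis
    using W.subspace_0[OF Hodge_subspace] by (auto simp: hodge_number_def)
qed

lemma hodge_number_sym: "hodge_number M p q = 0 \<longleftrightarrow> hodge_number M q p = 0"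
proof -
  interpret F: Vector_Spaces.linear "scaleBC M" "scaleBC M" "FrobC M" by (rule FrobC_linear)
  have swap: "Hodge M q p = {0}" if "Hodge M p q = {0}" for p q
    using Frob_Hodge[of p q] that F.zero by simp
  show ?thesis
    unfolding hodge_number_eq_0 using swap[of p q] swap[of q p] by metis
qed

text \<open>\<open>comparison_Fil\<close> matches the complexified filtration step with the Hodge
  spaces; complexification and the bijective comparison both keep dimensions.\<close>

lemma dim_Fil:
  "vector_space.dim (scaleD M) (Fil M k) =
     vector_space.dim (scaleBC M) (\<Union>{Hodge M p q | p q. p \<ge> k})"
proof -
  obtain B where "finite_dimensional_vector_space (scaleBC M) B"
    using finite_dimensional_BC by blast
  then interpret W: finite_dimensional_vector_space "scaleBC M" B .
  interpret finite_dimensional_vector_space_pair_1 "scaleBC M" B "scaleDC M" ..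
  have "inj_on (comparison M) S" for S
    using comparison_bij by (metis bij_def inj_on_subset subset_UNIV)
  then have "deRham.target.dim (comparison M ` W.span (\<Union>{Hodge M p q | p q. p \<ge> k})) =
      W.dim (W.span (\<Union>{Hodge M p q | p q. p \<ge> k}))"
    by (intro dim_image_eq comparison_linear)
  then show ?thesis
    unfolding comparison_Fil by (simp only: deRham.target.dim_span W.dim_span deRham.dim_image)
qed

lemma dim_deRham: "vector_space.dim (scaleD M) UNIV = vector_space.dim (scaleBC M) UNIV"
proof -
  obtain B where "finite_dimensional_vector_space (scaleBC M) B"
    using finite_dimensional_BC by blast
  then interpret W: finite_dimensional_vector_space "scaleBC M" B .
  interpret finite_dimensional_vector_space_pair_1 "scaleBC M" B "scaleDC M" ..
  have "deRham.source.dim UNIV = deRham.target.dim (deRham.target.span (range (incD M)))"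
    by (simp add: deRham.dim_image)
  also have "\<dots> = deRham.target.dim (comparison M ` UNIV)"
    using comparison_bij by (simp add: deRham.map_spanning bij_def)
  also have "\<dots> = W.dim UNIV"
    using comparison_bij by (intro dim_image_eq comparison_linear) (simp add: bij_def)
  finally show ?thesis .
qed

text \<open>By the first hypothesis, step 1 of the filtration, which is step 0 after the twist,
  consists of the Hodge spaces with \<open>q < p\<close>. The second puts the middle spaces into the
  \<open>-1\<close>-eigenspace, the one counted after the twist.\<close>

lemma critical_tate_twist:
  assumes type: "\<And>p q. Hodge M p q \<noteq> {0} \<Longrightarrow> 1 \<le> p \<longleftrightarrow> q < p"
    and middle: "\<And>p v. v \<in> Hodge M p p \<Longrightarrow> FrobC M v = - v"
  shows "critical (tate_twist M)"
proof -
  obtain B where "finite_dimensional_vector_space (scaleBC M) B"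
    using finite_dimensional_BC by blast
  then interpret W: finite_dimensional_vector_space "scaleBC M" B .
  interpret F: Vector_Spaces.linear "scaleBC M" "scaleBC M" "FrobC M" by (rule FrobC_linear)
  define H where "H = (\<lambda>(p, q). Hodge M p q)"
  have H: "is_internal_direct_sum (scaleBC M) H"
    unfolding H_def by (rule Hodge_decomposition)
  define A where "A = {(p :: int, q). q < p}"
  define A' where "A' = {(p :: int, q). p < q}"
  define U where "U = W.span (\<Union>{Hodge M p q | p q. p \<ge> 1})"
  define R where "R = {w. FrobC M w = - w}"
  have R: "W.subspace R"
    by (auto simp: R_def W.subspace_def F.zero F.add F.scale)
  have U: "W.subspace U"
    by (simp add: U_def)
  have U_sub: "U \<subseteq> W.span (\<Union>x\<in>A. H x)"
    unfolding U_def
  proof (rule W.span_minimal[OF _ W.subspace_span], safe)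
    fix v and p q :: int
    assume v: "v \<in> Hodge M p q" "1 \<le> p"
    show "v \<in> W.span (\<Union>x\<in>A. H x)"
    \<comment> \<open>\<open>type\<close> speaks of nonzero Hodge spaces only; a zero one lies in
      every span.\<close>
    proof (cases "Hodge M p q = {0}")
      case True
      then show ?thesis using v W.span_zero by auto
    next
      case False
      then have "(p, q) \<in> A" using type v by (auto simp: A_def)
      then show ?thesis using v by (intro W.span_base) (auto simp: H_def)
    qed
  qed
  have swap: "FrobC M ` W.span (\<Union>x\<in>A. H x) \<subseteq> W.span (\<Union>x\<in>A'. H x)"
    unfolding F.span_image[symmetric]
    using Frob_Hodge by (intro W.span_mono) (fastforce simp: A_def A'_def H_def)
  have "U \<inter> R = {0}"
  proof -
    have "v = 0" if "v \<in> U" "v \<in> R" for v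
    proof (rule W.direct_sum_span_disjoint[OF H])
      show "A \<inter> A' = {}" by (auto simp: A_def A'_def)
      show "v \<in> W.span (\<Union>x\<in>A. H x)" using that U_sub by blast
      then have "FrobC M v \<in> W.span (\<Union>x\<in>A'. H x)" using swap by blast
      then show "v \<in> W.span (\<Union>x\<in>A'. H x)"
        using that W.span_neg by (fastforce simp: R_def)
    qed
    then show ?thesis using W.subspace_0[OF U] W.subspace_0[OF R] by blast
  qed
  moreover have "{x + y | x y. x \<in> U \<and> y \<in> R} = UNIV" (is "?T = _")
  proof -
    have inU: "v \<in> U" if "v \<in> Hodge M p q" "q < p" for v p q
    proof (cases "Hodge M p q = {0}")
      case True
      then show ?thesis using that W.subspace_0[OF U] by auto
    next
      case False
      then have "1 \<le> p" using type that by blast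
      then show ?thesis unfolding U_def using that by (intro W.span_base) blast
    qed
    have "v \<in> ?T" if v: "v \<in> Hodge M p q" for v p q
    proof -
      consider "q < p" | "p = q" | "p < q" by linarith
      then show ?thesis
      proof cases
        case 1
        then have "v \<in> U" "0 \<in> R" "v = v + 0" using v inU W.subspace_0[OF R] by auto
        then show ?thesis by blast
      next
        case 2
        then have "0 \<in> U" "v \<in> R" "v = 0 + v"
          using v middle W.subspace_0[OF U] by (auto simp: R_def)
        then show ?thesis by blast
      next
        case 3
        have "FrobC M v \<in> U" using inU Frob_Hodge v 3 by blast
        moreover have "v - FrobC M v \<in> R" by (simp add: R_def F.diff FrobC_involution)
        moreover have "v = FrobC M v + (v - FrobC M v)" by simp
        ultimately show ?thesis by blast
      qed
    qed
    then have "(\<Union>x. H x) \<subseteq> ?T" by (auto simp: H_def)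
    then have "W.span (\<Union>x. H x) \<subseteq> ?T"
      by (rule W.span_minimal[OF _ W.subspace_sums[OF U R]])
    then show ?thesis
      unfolding W.direct_sum_span_UNIV[OF H] by (rule top.extremum_uniqueI)
  qed
  ultimately have "W.dim UNIV = W.dim U + W.dim R"
    using W.dim_sums_Int[OF U R] by simp
  \<comment> \<open>Both dimensions descend to \<open>E\<close>: that of \<open>U\<close> by the
    comparison, that of \<open>R\<close> because the eigenspace is spanned by vectors of the Betti
    realisation.\<close>
  moreover have "W.dim U = deRham.source.dim (Fil M 1)"
    by (simp add: U_def dim_Fil)
  moreover have "W.dim R = betti.source.dim {v. Frob M v = - v}"
    unfolding R_def
      betti.span_image_antiinvariants[OF Frob_linear Frob_involution FrobC_linear FrobC_extends,
        symmetric]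
    by (simp add: betti.dim_image)
  moreover have "{v. - Frob M v = v} = {v. Frob M v = - v}"
    by (auto simp: minus_equation_iff)
  \<comment> \<open>The subtraction in \<open>critical\<close> is on naturals; the sum formula shows
    that no truncation occurs.\<close>
  ultimately show ?thesis
    by (simp add: critical_def tate_twist_def dim_deRham del: W.dim_UNIV)
qed

text \<open>Applying \<open>FrobC\<close> twice to a nonzero vector multiplies it by
  \<open>c * c\<close>, which must then be 1.\<close>

lemma Frob_scalar_on_Hodge:
  assumes "hodge_number M k k \<noteq> 0" "\<And>v. v \<in> Hodge M k k \<Longrightarrow> FrobC M v = scaleBC M c v"
  shows "c = 1 \<or> c = - 1"
proof -
  interpret F: Vector_Spaces.linear "scaleBC M" "scaleBC M" "FrobC M" by (rule FrobC_linear)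
  obtain v where v: "v \<in> Hodge M k k" "v \<noteq> 0"
    using assms(1) W.subspace_0[OF Hodge_subspace] unfolding hodge_number_eq_0 by blast
  have "scaleBC M (c * c) v = scaleBC M 1 v"
    using FrobC_involution[of v] assms(2)[OF v(1)] by (simp add: F.scale)
  then have "c * c = 1"
    using v(2) W.scale_right_imp_eq by blast
  then show ?thesis by (simp add: square_eq_1_iff)
qed

end

section \<open>From pairings with coroots to the Hodge type\<close>

lemma least_positive_value_le:
  assumes "finite R" "\<gamma> \<in> R" "pairing x (coroot \<gamma>) > 0"
  shows "least_positive_value coroot x R \<le> ereal (pairing x (coroot \<gamma>))"
proof -
  let ?V = "{pairing x (coroot \<gamma>) | \<gamma>. \<gamma> \<in> R \<and> pairing x (coroot \<gamma>) > 0}"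
  have "finite ?V" "pairing x (coroot \<gamma>) \<in> ?V"
    using assms by auto
  then have "Min ?V \<le> pairing x (coroot \<gamma>)" "?V \<noteq> {}" by auto
  then show ?thesis
    unfolding least_positive_value_def Let_def by simp
qed

theorem proposition3p2:
  fixes \<Phi> Pos :: "(int ^ 'n) set" and coroot :: "int ^ 'n \<Rightarrow> int ^ 'n" and \<alpha> :: "int ^ 'n"
    and lam :: "real ^ 'n" and i :: nat and s :: real and b :: ereal and wt :: int
    and M :: "('e :: field_char_0, 'b :: ab_group_add, 'bc :: ab_group_add,
               'd :: ab_group_add, 'dc :: ab_group_add) premotive"
  assumes "reduced_root_datum \<Phi> coroot"
    and "is_positive_system \<Phi> Pos"
    and "\<alpha> \<in> simple_roots Pos"
    and "dominant coroot (levi_simple_roots Pos \<alpha>) lam"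
    and "i \<in> {1..max_grade \<Phi> coroot Pos \<alpha>}"
    and "b = least_positive_value coroot lam (graded_roots \<Phi> coroot Pos \<alpha> i)"
    and "algebraically_integral \<Phi> coroot (lam + s *\<^sub>R alpha_tilde \<Phi> coroot Pos \<alpha>)"
    and "premotivic_structure M"
    and "has_hodge_type M
           (image_mset (\<lambda>\<gamma>. (- pairing lam (coroot \<gamma>) - real i * s,
                              pairing lam (coroot \<gamma>) - real i * s)) 
                (mset_set (graded_roots \<Phi> coroot Pos \<alpha> i)))"
    and "of_int wt = - 2 * real i * s - 2"
  shows "(odd wt \<or> even wt \<and> hodge_number (tate_twist M) (wt div 2) (wt div 2) = 0 \<longrightarrow>
            0 < s \<and> ereal s \<le> (b - 1) / ereal (real i) \<longrightarrow> critical (tate_twist M))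
       \<and> (even wt \<and> hodge_number (tate_twist M) (wt div 2) (wt div 2) \<noteq> 0 \<longrightarrow>
            (\<forall>c. (\<forall>v\<in>Hodge (tate_twist M) (wt div 2) (wt div 2).
                     FrobC (tate_twist M) v = scaleBC (tate_twist M) c v) \<longrightarrow>
               (\<exists>t\<in>{0, 1 :: nat}. c = (-1) ^ t \<and>
                  (t = 0 \<longrightarrow>
                     0 < s \<and> ereal s \<le> (b - 1) / ereal (real i) \<longrightarrow> critical (tate_twist M)))))"
proof -
  interpret premotivic_structure M by fact
  interpret F: Vector_Spaces.linear "scaleBC M" "scaleBC M" "FrobC M" by (rule FrobC_linear)
  define R where "R = graded_roots \<Phi> coroot Pos \<alpha> i"
  define x where "x = (\<lambda>\<gamma>. pairing lam (coroot \<gamma>))"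
  \<comment> \<open>The twist shifts both Hodge indices by one, so for even \<open>wt\<close> its
    middle space is \<open>Hodge M k k\<close>.\<close>
  define k where "k = wt div 2 + 1"
  have i: "i \<ge> 1" using assms(5) by simp
  have "Pos \<subseteq> \<Phi>"
    using assms(2) by (auto simp: is_positive_system_def)
  then have finR: "finite R"
    using reduced_root_datum.finite_roots[OF assms(1)]
    by (auto simp: R_def graded_roots_def nilradical_roots_def intro: finite_subset)
  have in_type: "\<exists>\<gamma>\<in>R. of_int p = - x \<gamma> - real i * s \<and> of_int q = x \<gamma> - real i * s"
    if "hodge_number M p q \<noteq> 0" for p q
  proof -
    let ?A = "image_mset (\<lambda>\<gamma>. (- x \<gamma> - real i * s, x \<gamma> - real i * s)) (mset_set R)"
    have "hodge_number M p q = count ?A (of_int p, of_int q)"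
      using assms(9) unfolding has_hodge_type_def x_def R_def by blast
    then have "count ?A (of_int p, of_int q) \<noteq> 0"
      using that by simp
    then have "(of_int p, of_int q) \<in># ?A"
      unfolding count_eq_zero_iff by simp
    then show ?thesis using finR by auto
  qed
  \<comment> \<open>Adding the two coordinates gives \<open>2 * p = wt + 2\<close>, so
    \<open>(k, k)\<close> is the only diagonal pair that can occur, and only for even
    weight.\<close>
  have diag: "even wt \<and> p = k" if ne: "hodge_number M p p \<noteq> 0" for p
  proof -
    obtain \<gamma> where "real_of_int p = - x \<gamma> - real i * s" "real_of_int p = x \<gamma> - real i * s"
      using in_type[OF ne] by blast
    then have "real_of_int wt = real_of_int (2 * p - 2)"
      using assms(10) by simp
    then have "wt = 2 * p - 2" by linarith
    then show ?thesis by (auto simp: k_def)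
  qed
  have twist_num: "hodge_number (tate_twist M) (wt div 2) (wt div 2) = hodge_number M k k"
    by (simp add: hodge_number_def tate_twist_def k_def)
  have critical: "critical (tate_twist M)"
    if s: "0 < s" "ereal s \<le> (b - 1) / ereal (real i)"
      and mid: "\<And>p v. v \<in> Hodge M p p \<Longrightarrow> FrobC M v = - v"
  proof (rule critical_tate_twist[OF _ mid])
    fix p q assume "Hodge M p q \<noteq> {0}"
    then have ne: "hodge_number M p q \<noteq> 0" "hodge_number M q p \<noteq> 0"
      using hodge_number_eq_0 hodge_number_sym by auto
    have is_pos: "real i * s > 0" using i s by simp
    have "ereal s * ereal (real i) \<le> b - 1"
      using s(2) i by (subst (asm) ereal_le_divide_pos) (auto simp: mult.commute)
    \<comment> \<open>For infinite \<open>b\<close> the premise \<open>b \<le> ereal y\<close>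
      fails, so only finite \<open>b\<close> has content.\<close>
    then have gap: "real i * s + 1 \<le> y" if "b \<le> ereal y" for y
      using that by (cases b) (auto simp: mult.commute one_ereal_def)
    obtain \<gamma> where \<gamma>: "of_int p = - x \<gamma> - real i * s" "of_int q = x \<gamma> - real i * s"
      using in_type[OF ne(1)] by blast
    \<comment> \<open>The bound \<open>b\<close> controls positive values only, so the symmetric
      pair \<open>(q, p)\<close> supplies a root with the opposite value:
      \<open>x \<delta> = - x \<gamma>\<close>. If \<open>q < p\<close>, this value is positive and
      the gap gives \<open>1 \<le> p\<close>; conversely \<open>1 \<le> p\<close> makes it
      positive.\<close>
    obtain \<delta> where \<delta>: "\<delta> \<in> R" "of_int q = - x \<delta> - real i * s"
      using in_type[OF ne(2)] by blast
    have "real i * s + 1 \<le> x \<delta>" if "x \<delta> > 0"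
      using least_positive_value_le[OF finR \<delta>(1)] that
      by (intro gap) (simp add: assms(6) R_def x_def)
    moreover have "1 \<le> p \<longleftrightarrow> 1 \<le> real_of_int p" "q < p \<longleftrightarrow> real_of_int q < real_of_int p"
      by simp_all
    ultimately show "1 \<le> p \<longleftrightarrow> q < p"
      using \<gamma> \<delta> is_pos by linarith
  qed
  have part1: "critical (tate_twist M)"
    if "odd wt \<or> even wt \<and> hodge_number M k k = 0" "0 < s" "ereal s \<le> (b - 1) / ereal (real i)"
  proof (rule critical[OF that(2,3)])
    \<comment> \<open>Here \<open>diag\<close> leaves no nonzero diagonal Hodge space.\<close>
    fix p v assume "v \<in> Hodge M p p"
    moreover have "hodge_number M p p = 0" using diag[of p] that(1) by metis
    ultimately have "v = 0" by (simp add: hodge_number_eq_0)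
    then show "FrobC M v = - v" by (simp add: F.zero)
  qed
  have part2: "\<exists>t\<in>{0, 1 :: nat}. c = (-1) ^ t \<and>
      (t = 0 \<longrightarrow> 0 < s \<and> ereal s \<le> (b - 1) / ereal (real i) \<longrightarrow> critical (tate_twist M))"
    if ne: "hodge_number M k k \<noteq> 0" and c: "\<forall>v\<in>Hodge M k k. - FrobC M v = scaleBC M c v" for c
  proof -
    \<comment> \<open>The twist negates \<open>FrobC\<close>, so the scalar \<open>c\<close> after
      the twist is \<open>- c\<close> on \<open>M\<close>; the condition \<open>t = 0\<close>, that
      is \<open>c = 1\<close>, gives the \<open>-1\<close> required in the middle.\<close>
    have c': "FrobC M v = scaleBC M (- c) v" if "v \<in> Hodge M k k" for v
      using c that by (metis F.vs1.scale_minus_left minus_minus)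
    have "critical (tate_twist M)" if "c = 1" "0 < s" "ereal s \<le> (b - 1) / ereal (real i)"
    proof (rule critical[OF that(2,3)])
      fix p v assume v: "v \<in> Hodge M p p"
      show "FrobC M v = - v"
      proof (cases "p = k")
        case True
        then show ?thesis using c' v that(1) by simp
      next
        case False
        then have "hodge_number M p p = 0" using diag by blast
        then have "v = 0" using v by (simp add: hodge_number_eq_0)
        then show ?thesis by (simp add: F.zero)
      qed
    qed
    moreover have "- c = 1 \<or> - c = - 1"
      by (rule Frob_scalar_on_Hodge[OF ne c'])
    then have "c = 1 \<or> c = - 1" by (auto simp: minus_equation_iff)
    ultimately show ?thesis by auto
  qed
  have twist: "Hodge (tate_twist M) (wt div 2) (wt div 2) = Hodge M k k"
    "FrobC (tate_twist M) = (\<lambda>v. - FrobC M v)" "scaleBC (tate_twist M) = scaleBC M"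
    by (simp_all add: tate_twist_def k_def)
  show ?thesis
    unfolding twist_num twist using part1 part2 by blast
qed

end
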